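(* Let $F=\mathbb{F}_q$ with $q=p^r$ odd, and let $(F,+,\circ)$ be a finite symplectic presemifield. Then the bases $$B_\infty=\{e_w\mid w\in F\},\qquad B_m=\{b_{m,v}\mid v\in F\}\ (m\in F),\qquad b_{m,v}=\frac{1}{\sqrt q}\sum_{w\in F}\omega^{{\rm tr}(\frac12 w\cdot(w\circ m)+v\cdot w)}e_w,$$ form a complete set of mutually unbiased bases of $\mathbb{C}^q$.
   Context: ${\rm tr}:\mathbb{F}_q\to\mathbb{F}_p$ is the absolute trace, $\omega\in\mathbb{C}$ is a primitive $p$-th root of unity, and $\{e_w\}_{w\in F}$ is the standard basis of $\mathbb{C}^q$ indexed by $F$. A presemifield $(F,+,\circ)$ is the additive group of $F$ with a multiplication $\circ$ that is left and right distributive over $+$ and has no zero divisors. It determines the spread consisting of the subspaces $\{(0,y)\mid y\in F\}$ and $\{(x,x\circ y)\mid x\in F\}$, $y\in F$, of $F\oplus F$. The presemifield is called symplectic if each of these subspaces is totally isotropic with respect to the alternating form $\langle (u,v),(u',v')\rangle={\rm tr}(uv'-vu')$ on $F\oplus F$ (viewed over $\mathbb{F}_p$). A complete set of mutually unbiased bases of $\mathbb{C}^q$ is a set of $q+1$ orthonormal bases such that $|(x,y)|^2=1/q$ for any $x,y$ from distinct bases. *)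

theory Defs
  imports "HOL-Analysis.Analysis"
begin

section \<open>The absolute trace and additive exponents\<close>

text \<open>
  For a field of cardinality \<open>p ^ r\<close> the absolute trace is the sum of the conjugates
  under the Frobenius map. Its values lie in the prime subfield, but here still have type \<open>'a\<close>.
\<close>

definition abs_trace :: "nat \<Rightarrow> nat \<Rightarrow> 'a::field \<Rightarrow> 'a" where
  "abs_trace p r x = (\<Sum>i<r. x ^ (p ^ i))"

text \<open>
  The least non-negative integer representing an element of the prime subfield of a field of
  characteristic \<open>p\<close>; this makes sense of \<open>\<omega>\<close> raised to an element of that subfield.
  It is only meaningful for elements of the prime subfield.
\<close>

definition prime_field_rep :: "nat \<Rightarrow> 'a::field \<Rightarrow> nat" where
  "prime_field_rep p z = (THE k. k < p \<and> of_nat k = z)"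

definition primitive_root_of_unity :: "nat \<Rightarrow> complex \<Rightarrow> bool" where
  "primitive_root_of_unity n \<omega> \<longleftrightarrow>
     0 < n \<and> \<omega> ^ n = 1 \<and> (\<forall>k. 0 < k \<and> k < n \<longrightarrow> \<omega> ^ k \<noteq> 1)"

section \<open>Symplectic presemifields\<close>

definition presemifield :: "('a::field \<Rightarrow> 'a \<Rightarrow> 'a) \<Rightarrow> bool" where
  "presemifield f \<longleftrightarrow>
     (\<forall>x y z. f x (y + z) = f x y + f x z) \<and>
     (\<forall>x y z. f (x + y) z = f x z + f y z) \<and>
     (\<forall>x y. f x y = 0 \<longrightarrow> x = 0 \<or> y = 0)"

definition presemifield_spread :: "('a::field \<Rightarrow> 'a \<Rightarrow> 'a) \<Rightarrow> ('a \<times> 'a) set set" where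
  "presemifield_spread f = insert {(0, y) |y. True} {{(x, f x y) |x. True} |y. True}"

definition trace_form :: "nat \<Rightarrow> nat \<Rightarrow> 'a::field \<times> 'a \<Rightarrow> 'a \<times> 'a \<Rightarrow> 'a" where
  "trace_form p r a b = abs_trace p r (fst a * snd b - snd a * fst b)"

definition totally_isotropic :: "('v \<Rightarrow> 'v \<Rightarrow> 'a::zero) \<Rightarrow> 'v set \<Rightarrow> bool" where
  "totally_isotropic B W \<longleftrightarrow> (\<forall>a\<in>W. \<forall>b\<in>W. B a b = 0)"

definition symplectic_presemifield ::
    "nat \<Rightarrow> nat \<Rightarrow> ('a::field \<Rightarrow> 'a \<Rightarrow> 'a) \<Rightarrow> bool" where
  "symplectic_presemifield p r f \<longleftrightarrow>
     presemifield f \<and> (\<forall>W\<in>presemifield_spread f. totally_isotropic (trace_form p r) W)"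

section \<open>Mutually unbiased bases\<close>

text \<open>
  The library's inner product on \<open>complex ^ 'n\<close> is the real one, so the
  Hermitian inner product is defined here. Likewise, the unqualified \<open>span\<close> is the real
  span; the versions over the complex scalars are those prefixed with \<open>vec\<close>.
\<close>

definition hermitian_inner :: "complex ^ 'n \<Rightarrow> complex ^ 'n \<Rightarrow> complex" where
  "hermitian_inner x y = (\<Sum>i\<in>UNIV. x $ i * cnj (y $ i))"

definition orthonormal_basis :: "(complex ^ 'n) set \<Rightarrow> bool" where
  "orthonormal_basis B \<longleftrightarrow>
     vec.independent B \<and> vec.span B = UNIV \<and>
     (\<forall>x\<in>B. \<forall>y\<in>B. hermitian_inner x y = (if x = y then 1 else 0))"

definition complete_mub :: "(complex ^ 'n) set set \<Rightarrow> bool" where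
  "complete_mub \<B> \<longleftrightarrow>
     card \<B> = CARD('n) + 1 \<and>
     (\<forall>B\<in>\<B>. orthonormal_basis B) \<and>
     (\<forall>B\<in>\<B>. \<forall>B'\<in>\<B>. B \<noteq> B' \<longrightarrow>
        (\<forall>x\<in>B. \<forall>y\<in>B'. (cmod (hermitian_inner x y))\<^sup>2 = 1 / real CARD('n)))"

text \<open>The standard basis vector \<open>e\<^sub>w\<close> is \<open>axis w 1\<close>.\<close>

definition mub_vector ::
    "nat \<Rightarrow> nat \<Rightarrow> complex \<Rightarrow> ('a \<Rightarrow> 'a \<Rightarrow> 'a) \<Rightarrow> 'a \<Rightarrow> 'a \<Rightarrow> complex ^ ('a::{field,finite})"
  where
  "mub_vector p r \<omega> f m v =
     complex_of_real (1 / sqrt (real CARD('a))) *s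
       (\<Sum>w\<in>UNIV. \<omega> ^ prime_field_rep p (abs_trace p r (1 / 2 * (w * f w m) + v * w))
          *s axis w 1)"

end

theory Submission
  imports Defs "HOL-Number_Theory.Cong"
begin

text \<open>
  Up to the factor \<open>1/q\<close>, the inner products between distinct bases \<open>B\<^sub>m\<close> and \<open>B\<^sub>n\<close> are quadratic
  Gauss sums \<open>S = \<Sum>\<^sub>w \<psi> (1/2 w (w \<circ> k) + a w)\<close> with \<open>k = m - n \<noteq> 0\<close> and \<open>\<psi>\<close> the trace character.
  Shifting one of the two summation variables in \<open>\<bar>S\<bar>\<^sup>2\<close> by the other produces the cross terms
  \<open>1/2 (w (u \<circ> k) + u (w \<circ> k))\<close>, which by the symplectic condition may be replaced by
  \<open>u (w \<circ> k)\<close>. Summing over \<open>u\<close> kills every \<open>w\<close> with \<open>w \<circ> k \<noteq> 0\<close>, so only \<open>w = 0\<close> survives, and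
  \<open>\<bar>S\<bar>\<^sup>2 = q\<close>.
\<close>

section \<open>Orthonormal bases\<close>

lemma hermitian_inner_sum_scale_left:
  "hermitian_inner (\<Sum>v\<in>B. c v *s v) y = (\<Sum>v\<in>B. c v * hermitian_inner v y)"
proof -
  have "hermitian_inner (\<Sum>v\<in>B. c v *s v) y = (\<Sum>i\<in>UNIV. \<Sum>v\<in>B. c v * (v $ i * cnj (y $ i)))"
    by (simp add: hermitian_inner_def sum_distrib_right mult.assoc)
  also have "\<dots> = (\<Sum>v\<in>B. c v * hermitian_inner v y)"
    by (subst sum.swap) (simp add: hermitian_inner_def sum_distrib_left)
  finally show ?thesis .
qed

text \<open>Pairing a linear relation with a basis vector isolates its coefficient, which gives
  independence. As \<open>b\<close> is injective and indexed by the coordinates themselves, its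
  range has full cardinality and therefore spans.\<close>

lemma orthonormal_basis_range:
  fixes b :: "'n::finite \<Rightarrow> complex ^ 'n"
  assumes b: "\<And>i j. hermitian_inner (b i) (b j) = (if i = j then 1 else 0)"
  shows "orthonormal_basis (range b)"
proof -
  have inj: "inj b"
  proof (rule injI)
    fix i j assume "b i = b j"
    with b[of i j] b[of j j] show "i = j" by (simp split: if_splits)
  qed
  have on: "hermitian_inner x y = (if x = y then 1 else 0)" if "x \<in> range b" "y \<in> range b" for x y
    using that b injD[OF inj] by auto
  have ind: "vec.independent (range b)"
    unfolding vec.independent_explicit
  proof (intro conjI allI impI ballI)
    fix c v assume 0: "(\<Sum>v\<in>range b. c v *s v) = 0" and v: "v \<in> range b"
    have "0 = hermitian_inner (\<Sum>v\<in>range b. c v *s v) v"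
      unfolding 0 by (simp add: hermitian_inner_def)
    also have "\<dots> = (\<Sum>x\<in>range b. if x = v then c x else 0)"
      unfolding hermitian_inner_sum_scale_left by (intro sum.cong) (use v on in auto)
    also have "\<dots> = c v"
      using v by simp
    finally show "c v = 0" by simp
  qed simp
  have "UNIV \<subseteq> vec.span (range b)"
    by (rule vec.card_ge_dim_independent)
      (use ind inj in \<open>auto simp: card_image card_cart_basis\<close>)
  thus ?thesis
    using ind on by (auto simp: orthonormal_basis_def)
qed

lemma card_range_eq_add_one:
  fixes b :: "'i::finite \<Rightarrow> 'b set"
  assumes "\<And>i j. b i = b j \<Longrightarrow> i = j" and "\<And>i. b i \<noteq> c"
  shows "card (insert c (range b)) = CARD('i) + 1"
proof -
  have "c \<notin> range b" using assms(2) by blast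
  moreover have "inj b" using assms(1) by (rule injI)
  ultimately show ?thesis by (simp add: card_image)
qed

section \<open>Nontrivial additive characters\<close>

text \<open>Isolates what the Gauss sum computation needs, so that it can be done without the
  integer representatives behind the trace character.\<close>

locale nontrivial_additive_character =
  fixes \<psi> :: "'a::{field,finite} \<Rightarrow> complex"
  assumes add: "\<psi> (x + y) = \<psi> x * \<psi> y"
    and cmod_eq_1 [simp]: "cmod (\<psi> x) = 1"
    and nontrivial: "\<exists>x. \<psi> x \<noteq> 1"
begin

lemma nonzero [simp]: "\<psi> x \<noteq> 0"
  using cmod_eq_1[of x] by fastforce

lemma zero [simp]: "\<psi> 0 = 1"
  using add[of 0 0] by simp

lemma cnj_eq: "cnj (\<psi> x) = \<psi> (- x)"
proof -
  have "\<psi> x * cnj (\<psi> x) = \<psi> x * \<psi> (- x)"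
    by (simp add: complex_norm_square[symmetric] add[symmetric])
  thus ?thesis by simp
qed

text \<open>Translation by some \<open>y\<close> with \<open>\<psi> y \<noteq> 1\<close> preserves
  the sum, yet multiplies it by \<open>\<psi> y\<close>.\<close>

lemma sum_UNIV: "(\<Sum>x\<in>UNIV. \<psi> x) = 0"
proof -
  obtain y where y: "\<psi> y \<noteq> 1" using nontrivial by blast
  have "(\<Sum>x\<in>UNIV. \<psi> x) = (\<Sum>x\<in>UNIV. \<psi> (y + x))"
    by (rule sum.reindex_bij_witness[of _ "\<lambda>x. y + x" "\<lambda>x. x - y"]) auto
  also have "\<dots> = \<psi> y * (\<Sum>x\<in>UNIV. \<psi> x)"
    by (simp add: add sum_distrib_left)
  finally show ?thesis using y by simp
qed

lemma sum_mult: "(\<Sum>x\<in>UNIV. \<psi> (x * a)) = (if a = 0 then of_nat CARD('a) else 0)"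
proof (cases "a = 0")
  case False
  hence "(\<Sum>x\<in>UNIV. \<psi> (x * a)) = (\<Sum>x\<in>UNIV. \<psi> x)"
    by (intro sum.reindex_bij_witness[of _ "\<lambda>x. x / a" "\<lambda>x. x * a"]) auto
  with False show ?thesis by (simp add: sum_UNIV)
qed simp

text \<open>Applied with \<open>g\<close> a right multiplication of the presemifield. Isotropy only
  puts \<open>x * g y - y * g x\<close> in the kernel of the trace, so \<open>sym\<close> is stated
  after applying \<psi>, not as an equality in the field.\<close>

lemma norm_quadratic_sum:
  fixes g :: "'a \<Rightarrow> 'a"
  assumes g_add: "\<And>x y. g (x + y) = g x + g y"
    and g_zero: "\<And>x. g x = 0 \<Longrightarrow> x = 0"
    and sym: "\<And>x y. \<psi> (x * g y - y * g x) = 1"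
    and two: "(2::'a) \<noteq> 0"
  shows "(cmod (\<Sum>w\<in>UNIV. \<psi> (1 / 2 * (w * g w) + a * w)))\<^sup>2 = real CARD('a)"
proof -
  define Q where "Q = (\<lambda>w. 1 / 2 * (w * g w) + a * w)"
  have g0: "g 0 = 0" using g_add[of 0 0] by (metis add_0_right add_left_cancel)
  \<comment> \<open>\<open>g\<close> is additive but perhaps not linear over the field; still, twice
    \<open>g (x / 2)\<close> is \<open>g x\<close>.\<close>
  have half: "g (x / 2) = g x / 2" for x
    using g_add[of "x / 2" "x / 2"] two by (simp add: field_simps)
  have shift: "\<psi> (Q (w + u)) * \<psi> (- Q u) = \<psi> (Q w) * \<psi> (u * g w)" for u w
  proof -
    \<comment> \<open>The last bracket is an instance of \<open>sym\<close> with arguments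
      \<open>w / 2\<close> and \<open>u\<close>, hence invisible to \<psi>.\<close>
    have "Q (w + u) + - Q u = Q w + u * g w + (w / 2 * g u - u * g (w / 2))"
      unfolding half Q_def g_add using two by (simp add: field_simps)
    hence "\<psi> (Q (w + u)) * \<psi> (- Q u)
        = \<psi> (Q w + u * g w + (w / 2 * g u - u * g (w / 2)))"
      by (simp only: add[symmetric])
    also have "\<dots> = \<psi> (Q w) * \<psi> (u * g w)"
      unfolding add[of "Q w + u * g w"] sym by (simp add: add)
    finally show ?thesis .
  qed
  have "complex_of_real ((cmod (\<Sum>w\<in>UNIV. \<psi> (Q w)))\<^sup>2)
      = (\<Sum>w\<in>UNIV. \<psi> (Q w)) * (\<Sum>u\<in>UNIV. \<psi> (- Q u))"
    by (simp only: complex_norm_square cnj_sum cnj_eq)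
  also have "\<dots> = (\<Sum>u\<in>UNIV. \<Sum>w\<in>UNIV. \<psi> (Q w) * \<psi> (- Q u))"
    by (subst sum.swap) (simp add: sum_product)
  also have "\<dots> = (\<Sum>u\<in>UNIV. \<Sum>w\<in>UNIV. \<psi> (Q (w + u)) * \<psi> (- Q u))"
  proof (rule sum.cong[OF refl])
    fix u
    show "(\<Sum>w\<in>UNIV. \<psi> (Q w) * \<psi> (- Q u)) = (\<Sum>w\<in>UNIV. \<psi> (Q (w + u)) * \<psi> (- Q u))"
      by (rule sum.reindex_bij_witness[of _ "\<lambda>w. w + u" "\<lambda>w. w - u"]) auto
  qed
  also have "\<dots> = (\<Sum>w\<in>UNIV. \<psi> (Q w) * (\<Sum>u\<in>UNIV. \<psi> (u * g w)))"
    unfolding shift by (subst sum.swap) (simp add: sum_distrib_left)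
  also have "\<dots> = (\<Sum>w\<in>UNIV. if w = (0::'a) then of_nat CARD('a) else 0)"
  proof (rule sum.cong[OF refl])
    fix w
    show "\<psi> (Q w) * (\<Sum>u\<in>UNIV. \<psi> (u * g w)) = (if w = 0 then of_nat CARD('a) else 0)"
    proof (cases "w = 0")
      case False
      hence "g w \<noteq> 0" using g_zero by blast
      with False show ?thesis by (simp add: sum_mult)
    qed (simp add: Q_def g0)
  qed
  also have "\<dots> = complex_of_real (real CARD('a))"
    by simp
  finally show ?thesis
    unfolding Q_def of_real_eq_iff .
qed

end

section \<open>The trace character\<close>

lemma CARD_gt_1: "CARD('a::{zero_neq_one,finite}) > 1"
proof -
  have "card {0, 1 :: 'a} \<le> CARD('a)"
    by (rule card_mono) auto
  thus ?thesis by simp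
qed

text \<open>Multiplication by a nonzero \<open>x\<close> permutes the nonzero elements; comparing
  their products shows that the power of \<open>x\<close> to the number of them is 1.\<close>

lemma power_CARD_eq_same:
  fixes x :: "'a::{field,finite}"
  shows "x ^ CARD('a) = x"
proof (cases "x = 0")
  case False
  let ?U = "UNIV - {0 :: 'a}"
  have "(\<Prod>y\<in>?U. y) = (\<Prod>y\<in>?U. x * y)"
    by (rule prod.reindex_bij_witness[of _ "\<lambda>y. x * y" "\<lambda>y. y / x"]) (use False in auto)
  also have "\<dots> = x ^ card ?U * (\<Prod>y\<in>?U. y)"
    by (simp add: prod.distrib)
  finally have "x ^ card ?U = 1"
    by simp
  moreover have "CARD('a) = Suc (card ?U)"
    by (rule card_Suc_Diff1[symmetric]) auto
  ultimately show ?thesis by (simp only: power_Suc mult_1_right)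
qed simp

text \<open>Translating by 1 preserves the sum of all elements, so adding up that many ones gives
  0.\<close>

lemma CHAR_dvd_CARD: "CHAR('a::{ring_1,finite}) dvd CARD('a)"
proof -
  have "(\<Sum>x\<in>UNIV. x :: 'a) = (\<Sum>x\<in>UNIV. x + 1)"
    by (rule sum.reindex_bij_witness[of _ "\<lambda>x. x + 1" "\<lambda>x. x - 1"]) auto
  hence "of_nat CARD('a) = (0 :: 'a)"
    by (simp add: sum.distrib)
  thus ?thesis by (simp only: of_nat_eq_0_iff_char_dvd)
qed

lemma CHAR_eq_of_CARD_eq:
  assumes "prime p" and "CARD('a::{field,finite}) = p ^ r"
  shows "CHAR('a) = p"
proof -
  have "CHAR('a) dvd p ^ r" using CHAR_dvd_CARD[where ?'a = 'a] assms(2) by simp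
  moreover have "prime CHAR('a)"
    by (rule prime_CHAR_semidom) (simp add: finite_imp_CHAR_pos)
  ultimately show ?thesis
    using assms(1) prime_dvd_power primes_dvd_imp_eq by blast
qed

text \<open>The images of 0, ..., p - 1 are p distinct roots of X^p - X, which has at most p roots.
  This makes the definite description in \<open>prime_field_rep\<close> meaningful for
  Frobenius-fixed elements such as traces.\<close>

lemma of_nat_of_power_CHAR_eq_same:
  fixes z :: "'a::field"
  assumes p: "prime p" and char: "CHAR('a) = p" and z: "z ^ p = z"
  shows "\<exists>!k. k < p \<and> of_nat k = z"
proof -
  have p1: "p > 1" using p prime_gt_1_nat by blast
  have inj: "inj_on (of_nat :: nat \<Rightarrow> 'a) {..<p}"
    by (auto intro!: inj_onI simp: of_nat_eq_iff_cong_CHAR char cong_def)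
  have root: "(of_nat k :: 'a) ^ p = of_nat k" for k
  proof (induction k)
    case (Suc k)
    have "(1 + of_nat k :: 'a) ^ p = 1 ^ p + of_nat k ^ p"
      by (rule freshmans_dream) (use p char in auto)
    with Suc show ?case by simp
  qed (use p1 in simp)
  define P :: "'a poly" where "P = monom 1 p - monom 1 1"
  have "coeff P p = 1" using p1 by (simp add: P_def)
  hence P0: "P \<noteq> 0" by auto
  have degP: "degree P \<le> p"
    unfolding P_def using p1 by (intro degree_diff_le) (auto simp: degree_monom_eq)
  have roots: "{x. poly P x = 0} = {x. x ^ p = x}"
    by (auto simp: P_def poly_monom)
  have "of_nat ` {..<p} = {x :: 'a. x ^ p = x}"
  proof (rule card_seteq)
    show "finite {x :: 'a. x ^ p = x}"
      using poly_roots_finite[OF P0] roots by simp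
    show "card {x :: 'a. x ^ p = x} \<le> card (of_nat ` {..<p} :: 'a set)"
      using card_poly_roots_bound[OF P0] degP roots by (simp add: card_image[OF inj])
  qed (use root in auto)
  with z have "z \<in> of_nat ` {..<p}" by blast
  with inj show ?thesis by (auto dest: inj_onD)
qed

lemma primitive_root_power_mod:
  assumes "primitive_root_of_unity n \<omega>"
  shows "\<omega> ^ (k mod n) = \<omega> ^ k"
proof -
  have "\<omega> ^ n = 1"
    using assms by (auto simp: primitive_root_of_unity_def)
  hence "\<omega> ^ (n * (k div n) + k mod n) = \<omega> ^ (k mod n)"
    by (simp only: power_add power_mult power_one mult_1_left)
  thus ?thesis by simp
qed

lemma primitive_root_power_eq_1_iff:
  assumes "primitive_root_of_unity n \<omega>"
  shows "\<omega> ^ k = 1 \<longleftrightarrow> n dvd k"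
proof -
  have "0 < n" "0 < k mod n \<Longrightarrow> k mod n < n \<Longrightarrow> \<omega> ^ (k mod n) \<noteq> 1"
    using assms by (auto simp: primitive_root_of_unity_def)
  thus ?thesis
    using primitive_root_power_mod[OF assms, of k] by (auto simp: mod_eq_0_iff_dvd)
qed

lemma primitive_root_power_cong:
  assumes "primitive_root_of_unity n \<omega>" and "[j = k] (mod n)"
  shows "\<omega> ^ j = \<omega> ^ k"
  using assms(2) primitive_root_power_mod[OF assms(1), of j]
    primitive_root_power_mod[OF assms(1), of k] by (simp add: cong_def)

definition trace_char :: "nat \<Rightarrow> nat \<Rightarrow> complex \<Rightarrow> 'a::field \<Rightarrow> complex" where
  "trace_char p r \<omega> x = \<omega> ^ prime_field_rep p (abs_trace p r x)"

context
  fixes p r :: nat and \<omega> :: complex and T :: "'a::{field,finite} itself"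
  assumes p: "prime p" and card: "CARD('a) = p ^ r" and \<omega>: "primitive_root_of_unity p \<omega>"
begin

lemma abs_trace_add: "abs_trace p r (x + y :: 'a) = abs_trace p r x + abs_trace p r y"
proof -
  have "(x + y) ^ (p ^ i) = x ^ (p ^ i) + y ^ (p ^ i)" for i
    by (rule freshmans_dream') (use p CHAR_eq_of_CARD_eq[OF p card] in auto)
  thus ?thesis by (simp add: abs_trace_def sum.distrib)
qed

text \<open>Frobenius shifts the conjugates by one place, and \<open>x ^ (p ^ r) = x\<close> closes
  the cycle.\<close>

lemma abs_trace_power: "abs_trace p r (x :: 'a) ^ p = abs_trace p r x"
proof -
  have "abs_trace p r x ^ p = (\<Sum>i<r. (x ^ (p ^ i)) ^ p)"
    unfolding abs_trace_def
    by (rule freshmans_dream_sum) (use p CHAR_eq_of_CARD_eq[OF p card] in auto)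
  also have "\<dots> = (\<Sum>i<r. x ^ (p ^ Suc i))"
    by (simp add: power_mult[symmetric] mult.commute)
  also have "\<dots> = (\<Sum>i<r. x ^ (p ^ i))"
  proof -
    have "(\<Sum>i<Suc r. x ^ (p ^ i)) = x + (\<Sum>i<r. x ^ (p ^ Suc i))"
      by (subst sum.lessThan_Suc_shift) simp
    moreover have "(\<Sum>i<Suc r. x ^ (p ^ i)) = (\<Sum>i<r. x ^ (p ^ i)) + x"
      using power_CARD_eq_same[of x] by (simp add: card)
    ultimately show ?thesis by simp
  qed
  finally show ?thesis by (simp add: abs_trace_def)
qed

text \<open>The trace is a polynomial function of degree at most \<open>p ^ (r - 1)\<close>, too
  small for a nonzero polynomial to vanish on the whole field.\<close>

lemma abs_trace_nontrivial: "\<exists>x :: 'a. abs_trace p r x \<noteq> 0"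
proof (rule ccontr)
  assume "\<nexists>x :: 'a. abs_trace p r x \<noteq> 0"
  hence tr0: "abs_trace p r x = 0" for x :: 'a by blast
  have p1: "p > 1" using p prime_gt_1_nat by blast
  \<comment> \<open>Excludes \<open>r = 0\<close>, for which the trace would be an empty
    sum.\<close>
  have "CARD('a) \<noteq> 1"
    using CARD_gt_1[where ?'a = 'a] by simp
  hence r: "r > 0" using card by (intro Nat.gr0I) simp
  define P :: "'a poly" where "P = (\<Sum>i<r. monom 1 (p ^ i))"
  \<comment> \<open>Since \<open>p > 1\<close>, only the summand \<open>i = 0\<close> has exponent
    1.\<close>
  have "coeff P 1 = (\<Sum>i<r. if i = 0 then 1 else 0)"
    unfolding P_def coeff_sum using p1 by (intro sum.cong) auto
  also have "\<dots> = 1" using r by simp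
  finally have P0: "P \<noteq> 0" by auto
  have "degree P \<le> p ^ (r - 1)"
    unfolding P_def using p1
    by (intro degree_sum_le) (auto simp: degree_monom_eq intro!: power_increasing)
  also have "\<dots> < CARD('a)"
    unfolding card using p1 r by (intro power_strict_increasing) auto
  also have "CARD('a) = card {x. poly P x = 0}"
    using tr0 by (simp add: P_def poly_sum poly_monom abs_trace_def)
  finally show False
    using card_poly_roots_bound[OF P0] by simp
qed

lemma prime_field_rep_trace:
  "prime_field_rep p (abs_trace p r x) < p"
  "of_nat (prime_field_rep p (abs_trace p r x)) = abs_trace p r (x :: 'a)"
  using theI'[OF of_nat_of_power_CHAR_eq_same[OF p CHAR_eq_of_CARD_eq[OF p card] abs_trace_power]]
  unfolding prime_field_rep_def by auto

text \<open>One direction turns isotropy into a statement about the character; the other makes the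
  character nontrivial.\<close>

lemma trace_char_eq_1_iff: "trace_char p r \<omega> (x :: 'a) = 1 \<longleftrightarrow> abs_trace p r x = 0"
  unfolding trace_char_def primitive_root_power_eq_1_iff[OF \<omega>]
  using of_nat_eq_0_iff_char_dvd[of "prime_field_rep p (abs_trace p r x)", where ?'a = 'a]
  by (simp add: prime_field_rep_trace(2) CHAR_eq_of_CARD_eq[OF p card])

text \<open>Integer representatives add up only modulo \<open>p\<close>, which
  \<open>\<omega> ^ p = 1\<close> absorbs.\<close>

lemma nontrivial_additive_character_trace_char:
  "nontrivial_additive_character (trace_char p r \<omega> :: 'a \<Rightarrow> complex)"
proof
  fix x y :: 'a
  let ?n = "\<lambda>x :: 'a. prime_field_rep p (abs_trace p r x)"
  have "(of_nat (?n (x + y)) :: 'a) = of_nat (?n x + ?n y)"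
    by (simp add: prime_field_rep_trace(2) flip: abs_trace_add)
  hence "[?n (x + y) = ?n x + ?n y] (mod p)"
    by (simp only: of_nat_eq_iff_cong_CHAR CHAR_eq_of_CARD_eq[OF p card])
  thus "trace_char p r \<omega> (x + y) = trace_char p r \<omega> x * trace_char p r \<omega> y"
    unfolding trace_char_def power_add[symmetric] by (rule primitive_root_power_cong[OF \<omega>])
  have "\<omega> ^ p = 1" "p > 0"
    using \<omega> by (auto simp: primitive_root_of_unity_def)
  hence "cmod \<omega> ^ p = 1" by (simp flip: norm_power)
  hence "cmod \<omega> = 1" using \<open>p > 0\<close> power_eq_imp_eq_base[of "cmod \<omega>" p 1] by simp
  thus "cmod (trace_char p r \<omega> x) = 1" by (simp add: trace_char_def norm_power)
next
  show "\<exists>x :: 'a. trace_char p r \<omega> x \<noteq> 1"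
    using abs_trace_nontrivial trace_char_eq_1_iff by auto
qed

end

section \<open>Mutually unbiased bases from symplectic presemifields\<close>

lemma hermitian_inner_axis: "hermitian_inner (axis i 1) x = cnj (x $ i)"
proof -
  have "hermitian_inner (axis i 1) x = (\<Sum>j\<in>UNIV. if j = i then cnj (x $ j) else 0)"
    unfolding hermitian_inner_def by (intro sum.cong) (auto simp: axis_def)
  thus ?thesis by simp
qed

lemma hermitian_inner_commute: "hermitian_inner x y = cnj (hermitian_inner y x)"
  by (simp add: hermitian_inner_def mult.commute)

lemma mub_vector_nth:
  "mub_vector p r \<omega> f m v $ w
     = complex_of_real (1 / sqrt (real CARD('a)))
       * trace_char p r \<omega> (1 / 2 * (w * f w m) + v * w :: 'a::{field,finite})"
proof -
  have "(\<Sum>i\<in>UNIV. c i *s axis i 1) $ w = c w" for c :: "'a \<Rightarrow> complex"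
  proof -
    have "(\<Sum>i\<in>UNIV. c i *s axis i 1) $ w = (\<Sum>i\<in>UNIV. if i = w then c i else 0)"
      unfolding sum_component by (intro sum.cong) (auto simp: axis_def)
    thus ?thesis by simp
  qed
  thus ?thesis by (simp add: mub_vector_def trace_char_def)
qed

text \<open>The points with first coordinates \<open>x\<close> and \<open>y\<close> on the spread
  member of \<open>m\<close> are orthogonal for the trace form.\<close>

lemma symplectic_presemifield_trace:
  assumes "symplectic_presemifield p r f"
  shows "abs_trace p r (x * f y m - y * f x m) = 0"
proof -
  have "{(x, f x m) |x. True} \<in> presemifield_spread f"
    by (auto simp: presemifield_spread_def)
  hence "totally_isotropic (trace_form p r) {(x, f x m) |x. True}"
    using assms by (auto simp: symplectic_presemifield_def)
  hence "trace_form p r (x, f x m) (y, f y m) = 0"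
    unfolding totally_isotropic_def by blast
  thus ?thesis by (simp add: trace_form_def mult.commute)
qed

theorem theorem3p3:
  fixes f :: "'a \<Rightarrow> 'a \<Rightarrow> 'a::{field,finite}"
    and p r :: nat
    and \<omega> :: complex
  assumes "prime p"
    and "CARD('a) = p ^ r"
    and "odd (CARD('a))"
    and "symplectic_presemifield p r f"
    and "primitive_root_of_unity p \<omega>"
  shows "complete_mub
           (insert {axis w 1 |w. True} {{mub_vector p r \<omega> f m v |v. True} |m. True})"
proof -
  define \<psi> where "\<psi> = (trace_char p r \<omega> :: 'a \<Rightarrow> complex)"
  interpret nontrivial_additive_character \<psi>
    unfolding \<psi>_def using assms by (intro nontrivial_additive_character_trace_char)
  let ?q = "CARD('a)"
  let ?e = "\<lambda>w. axis w 1 :: (complex, 'a) vec"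
  let ?b = "mub_vector p r \<omega> f"
  have q0: "real ?q > 0" by simp
  have char: "CHAR('a) = p" using assms by (intro CHAR_eq_of_CARD_eq)
  \<comment> \<open>Odd cardinality forces odd characteristic, so that 2 is invertible.\<close>
  have "p dvd ?q" using CHAR_dvd_CARD[where ?'a = 'a] char by simp
  with assms(3) have "p \<noteq> 2" by blast
  hence "\<not> p dvd 2"
    using assms(1) primes_dvd_imp_eq[of p 2] two_is_prime_nat by blast
  hence two: "(2::'a) \<noteq> 0"
    using of_nat_eq_0_iff_char_dvd[of 2, where ?'a = 'a] char by simp
  have f: "f x (y + z) = f x y + f x z" "f (x + y) z = f x z + f y z"
     "f x y = 0 \<Longrightarrow> x = 0 \<or> y = 0" for x y z
    using assms(4) by (auto simp: symplectic_presemifield_def presemifield_def)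
  have f_diff: "f x (y - z) = f x y - f x z" for x y z
    using f(1)[of x "y - z" z] by simp
  have f0: "f x 0 = 0" for x
    using f_diff[of x 0 0] by simp

  \<comment> \<open>Additivity of \<open>f\<close> in its second argument merges the two phases into
    a single one with parameters \<open>m - n\<close> and \<open>v - u\<close>.\<close>
  have inner: "hermitian_inner (?b m v) (?b n u)
      = (\<Sum>w\<in>UNIV. \<psi> (1 / 2 * (w * f w (m - n)) + (v - u) * w)) / of_nat ?q" for m n v u
  proof -
    have "of_real (1 / sqrt ?q) * of_real (1 / sqrt ?q) = (1 / of_nat ?q :: complex)"
      using q0 by (simp flip: of_real_mult)
    moreover have "\<psi> (1 / 2 * (w * f w m) + v * w) * cnj (\<psi> (1 / 2 * (w * f w n) + u * w))
        = \<psi> (1 / 2 * (w * f w (m - n)) + (v - u) * w)" for w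
      unfolding cnj_eq f_diff add[symmetric] by (simp add: algebra_simps)
    moreover have "c * x * (c * y) = c * c * (x * y)" for c x y :: complex
      by simp
    ultimately have "?b m v $ w * cnj (?b n u $ w)
        = \<psi> (1 / 2 * (w * f w (m - n)) + (v - u) * w) / of_nat ?q" for w
      unfolding mub_vector_nth \<psi>_def[symmetric] complex_cnj_mult complex_cnj_complex_of_real
      by (simp only: times_divide_eq_left mult_1_left)
    thus ?thesis
      by (simp add: hermitian_inner_def sum_divide_distrib)
  qed

  have on_b: "orthonormal_basis (range (?b m))" for m
  proof (rule orthonormal_basis_range)
    fix v u
    \<comment> \<open>Within one basis the quadratic term is \<open>f w 0 = 0\<close>, which leaves
      a linear character sum.\<close>
    have "(\<Sum>w\<in>UNIV. \<psi> ((v - u) * w)) = (if v = u then of_nat ?q else 0)"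
      using sum_mult[of "v - u"] by (simp add: mult.commute)
    thus "hermitian_inner (?b m v) (?b m u) = (if v = u then 1 else 0)"
      by (simp add: inner f0)
  qed
  have on_e: "orthonormal_basis (range ?e)"
    by (rule orthonormal_basis_range) (simp add: hermitian_inner_axis, simp add: axis_def)

  have bb: "(cmod (hermitian_inner (?b m v) (?b n u)))\<^sup>2 = 1 / real ?q" if "m \<noteq> n" for m n v u
  proof -
    have "(cmod (\<Sum>w\<in>UNIV. \<psi> (1 / 2 * (w * f w (m - n)) + (v - u) * w)))\<^sup>2 = real ?q"
    \<comment> \<open>Here \<open>g\<close> is \<open>\<lambda>w. f w (m - n)\<close>; it has
      trivial kernel because \<open>m - n\<close> is nonzero and there are no zero divisors.\<close>
    proof (rule norm_quadratic_sum)
      show "\<psi> (x * f y (m - n) - y * f x (m - n)) = 1" for x y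
        unfolding \<psi>_def using assms symplectic_presemifield_trace
        by (subst trace_char_eq_1_iff) auto
      show "x = 0" if "f x (m - n) = 0" for x
        using f(3)[OF that] \<open>m \<noteq> n\<close> by simp
    qed (simp_all add: f(2) two)
    thus ?thesis
      unfolding inner norm_divide power_divide by (simp add: power2_eq_square)
  qed
  \<comment> \<open>This inner product is a conjugated coordinate of \<open>?b m v\<close>, a unit
    complex number divided by the square root of q.\<close>
  have eb: "(cmod (hermitian_inner (?e w) (?b m v)))\<^sup>2 = 1 / real ?q" for w m v
    unfolding hermitian_inner_axis mub_vector_nth \<psi>_def[symmetric]
    by (simp add: norm_divide power_divide)
  have be: "(cmod (hermitian_inner (?b m v) (?e w)))\<^sup>2 = 1 / real ?q" for w m v
    using eb[of w m v] hermitian_inner_commute[of "?b m v" "?e w"] by simp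

  \<comment> \<open>The bases are counted as sets, so they must be shown distinct: a vector common
    to two of them would have squared self-product both 1 and 1/q. This is not circular, as
    \<open>bb\<close> assumes only distinct indices.\<close>
  have q1: "1 / real ?q \<noteq> 1"
    using CARD_gt_1[where ?'a = 'a] by simp
  have self: "(cmod (hermitian_inner (?b m v) (?b m v)))\<^sup>2 = 1" for m v
    using on_b[of m] by (simp add: orthonormal_basis_def)
  have "m = n" if "range (?b m) = range (?b n)" for m n
  proof (rule ccontr)
    obtain u where "?b m 0 = ?b n u" using \<open>range (?b m) = range (?b n)\<close> by blast
    moreover assume "m \<noteq> n"
    ultimately show False using bb[of m n 0 u] self[of n u] q1 by simp
  qed
  moreover have "range (?b m) \<noteq> range ?e" for m
  proof
    assume "range (?b m) = range ?e"
    then obtain w where "?b m 0 = ?e w" by blast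
    thus False using be[of m 0 w] self[of m 0] q1 by simp
  qed
  ultimately have card_bases: "card (insert (range ?e) (range (\<lambda>m. range (?b m)))) = ?q + 1"
    by (rule card_range_eq_add_one)
  have unbiased: "(cmod (hermitian_inner x y))\<^sup>2 = 1 / real ?q"
    if "B \<in> insert (range ?e) (range (\<lambda>m. range (?b m)))"
      "B' \<in> insert (range ?e) (range (\<lambda>m. range (?b m)))" "B \<noteq> B'" "x \<in> B" "y \<in> B'" for B B' x y
  proof (cases "B = range ?e")
    case True
    with that(2,3) obtain m where "B' = range (?b m)" by blast
    with True that(4,5) show ?thesis using eb by blast
  next
    case False
    with that(1) obtain m where m: "B = range (?b m)" by blast
    show ?thesis
    proof (cases "B' = range ?e")
      case True
      with m that(4,5) show ?thesis using be by blast
    next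
      case False
      with that(2) obtain n where n: "B' = range (?b n)" by blast
      with m that(3) have "m \<noteq> n" by blast
      with m n that(4,5) show ?thesis using bb by blast
    qed
  qed
  have "complete_mub (insert (range ?e) (range (\<lambda>m. range (?b m))))"
    unfolding complete_mub_def
  proof (intro conjI ballI impI)
    fix B assume "B \<in> insert (range ?e) (range (\<lambda>m. range (?b m)))"
    thus "orthonormal_basis B" using on_b on_e by blast
  qed (fact card_bases, fact unbiased)
  thus ?thesis
    by (simp add: full_SetCompr_eq)
qed

end
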